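(* Let $U=\{(x,ax^{q^i}):x\in\mathbb{F}_{q^n}\}$ with $a\in\mathbb{F}_{q^n}^*$ and $\gcd(n,i)=1$, and let $W$ be an $n$-dimensional $\mathbb{F}_q$-subspace of $\mathbb{F}_{q^n}^2$ with $L_U=L_W$. Then $W=\{(y,by^{q^j}):y\in\mathbb{F}_{q^n}\}$ for some $j$ with $\gcd(n,j)=1$ and some $b\in\mathbb{F}_{q^n}^*$ with $N_{q^n|q}(b)=N_{q^n|q}(a)$.
   Context: $L_X=\{\langle u\rangle_{\mathbb{F}_{q^n}}:u\in X\setminus\{0\}\}\subseteq\mathrm{PG}(1,q^n)$. $N_{q^n|q}(x)=x^{1+q+\dots+q^{n-1}}$ is the norm map. *)

theory Defs
  imports Main "HOL-Library.Product_Plus"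
begin

text \<open>The ambient field F_{q^n} is a finite field type 'a with CARD('a) = q^n.
  The subfield F_q is the set of elements fixed by x |-> x^q.\<close>

definition Fq :: "nat \<Rightarrow> ('a::field) set" where
  "Fq q = {x. x ^ q = x}"

definition smult2 :: "'a::field \<Rightarrow> 'a \<times> 'a \<Rightarrow> 'a \<times> 'a" where
  "smult2 c u = (c * fst u, c * snd u)"

definition Fq_subspace :: "nat \<Rightarrow> ('a::field \<times> 'a) set \<Rightarrow> bool" where
  "Fq_subspace q W \<longleftrightarrow> (0, 0) \<in> W \<and> (\<forall>u\<in>W. \<forall>v\<in>W. u + v \<in> W)
     \<and> (\<forall>c\<in>Fq q. \<forall>u\<in>W. smult2 c u \<in> W)"

definition Fq_lin_indep :: "nat \<Rightarrow> ('a::field \<times> 'a) set \<Rightarrow> bool" where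
  "Fq_lin_indep q B \<longleftrightarrow> (\<forall>c. (\<forall>b\<in>B. c b \<in> Fq q) \<longrightarrow>
      (\<Sum>b\<in>B. smult2 (c b) b) = (0, 0) \<longrightarrow> (\<forall>b\<in>B. c b = 0))"

definition Fq_span :: "nat \<Rightarrow> ('a::field \<times> 'a) set \<Rightarrow> ('a \<times> 'a) set" where
  "Fq_span q B = {(\<Sum>b\<in>B. smult2 (c b) b) | c. \<forall>b\<in>B. c b \<in> Fq q}"

definition Fq_subspace_dim :: "nat \<Rightarrow> ('a::field \<times> 'a) set \<Rightarrow> nat \<Rightarrow> bool" where
  "Fq_subspace_dim q W n \<longleftrightarrow> Fq_subspace q W \<and>
     (\<exists>B. finite B \<and> card B = n \<and> B \<subseteq> W \<and> Fq_lin_indep q B \<and> Fq_span q B = W)"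

text \<open>The F_{q^n}-span of a vector, i.e. a point of PG(1,q^n), and the linear set L_X.\<close>
definition Fqn_point :: "('a::field \<times> 'a) \<Rightarrow> ('a \<times> 'a) set" where
  "Fqn_point u = {smult2 c u | c. True}"

definition linset :: "('a::field \<times> 'a) set \<Rightarrow> ('a \<times> 'a) set set" where
  "linset X = {Fqn_point u | u. u \<in> X - {(0, 0)}}"

definition norm_qn :: "nat \<Rightarrow> nat \<Rightarrow> 'a::field \<Rightarrow> 'a" where
  "norm_qn q n x = x ^ (\<Sum>k<n. q ^ k)"

end

theory Submission
  imports Defs "HOL-Algebra.Sylow" "HOL-Computational_Algebra.Polynomial"
    "HOL-Number_Theory.Cong" "HOL-Library.FuncSet"
begin

text \<open>
  Since \<open>L\<^sub>W\<close> misses the point \<open>(0, 1)\<close>, the subspace \<open>W\<close> is the graph of a \<open>q\<close>-polynomial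
  \<open>g(y) = \<Sum>k<n. b\<^sub>k y ^ (q ^ k)\<close>. Comparing fibre sizes, the slopes \<open>g(y) / y\<close> and \<open>a x ^ (q ^ i) / x\<close>
  agree as multisets, so \<open>\<Sum>y\<noteq>0. (g(y) / y) ^ d = 0\<close> for \<open>d = \<Sum>j\<in>J. q ^ j\<close> whenever \<open>J\<close> is a
  proper nonempty subset of the integers modulo \<open>n\<close>. Expanding, this says that every proper
  principal subpermanent of the Dickson matrix \<open>(b\<^bsub>t-j\<^esub> ^ (q ^ j))\<close> vanishes. A shortest cycle of
  the digraph with edges \<open>x \<rightarrow> x + k\<close>, \<open>b\<^sub>k \<noteq> 0\<close>, has no chords, so the permanent on its vertex set
  is a single nonzero product; hence all cycles have length at least \<open>n\<close>. This forces exactly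
  one \<open>b\<^sub>k\<close> to be nonzero and \<open>k\<close> to be coprime to \<open>n\<close>.
\<close>

subsection \<open>Combinatorial lemmas\<close>

text \<open>A repeated vertex or a chord would cut off a shorter closed walk. The conclusion reads
  \<open>s t = s (Suc r)\<close> and not \<open>t = Suc r\<close> because the closing edge, with
  \<open>r = m - 1\<close>, leads back to \<open>t = 0\<close>.\<close>

lemma shortest_cycle_chordless:
  fixes E :: "('v \<times> 'v) set"
  assumes "m > 0" and closed: "s m = s 0"
    and step: "\<And>r. r < m \<Longrightarrow> (s r, s (Suc r)) \<in> E"
    and shortest: "\<And>l x. 0 < l \<Longrightarrow> (x, x) \<in> E ^^ l \<Longrightarrow> m \<le> l"
  shows "inj_on s {..<m}"
    and "\<And>r t. r < m \<Longrightarrow> t < m \<Longrightarrow> (s r, s t) \<in> E \<Longrightarrow> s t = s (Suc r)"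
proof -
  have walk: "(s u, s v) \<in> E ^^ (v - u)" if "u \<le> v" "v \<le> m" for u v
    unfolding relpow_fun_conv
    by (rule exI[of _ "\<lambda>r. s (u + r)"]) (use that step in auto)
  show "inj_on s {..<m}"
  proof (rule linorder_inj_onI')
    fix u v assume uv: "u \<in> {..<m}" "v \<in> {..<m}" "u < v"
    show "s u \<noteq> s v"
      using walk[of u v] shortest[of "v - u" "s u"] uv by auto
  qed
  fix r t assume rt: "r < m" "t < m" and e: "(s r, s t) \<in> E"
  show "s t = s (Suc r)"
  proof (cases "r < t")
    case True
    have "(s 0, s t) \<in> E ^^ (Suc r)"
      using walk[of 0 r] e rt by (auto intro: relpow_Suc_I)
    moreover have "(s t, s m) \<in> E ^^ (m - t)"
      using walk[of t m] rt by simp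
    ultimately have "(s 0, s m) \<in> E ^^ (Suc r + (m - t))"
      by (rule relpow_trans)
    then have "m \<le> Suc r + (m - t)"
      using shortest[of "Suc r + (m - t)" "s 0"] closed by auto
    then have "t = Suc r" using True rt by linarith
    then show ?thesis by simp
  next
    case False
    have "(s t, s t) \<in> E ^^ Suc (r - t)"
      using walk[of t r] e rt False by (auto intro: relpow_Suc_I)
    then have "m \<le> Suc (r - t)" using shortest by blast
    then have "t = 0" "Suc r = m" using rt by auto
    then show ?thesis using closed by simp
  qed
qed

section \<open>Base-\<open>q\<close> digits modulo \<open>q ^ n - 1\<close>\<close>

lemma digit_sum_less:
  fixes q :: nat
  assumes "q > 0" "\<And>r. r < n \<Longrightarrow> c r < q"
  shows "(\<Sum>r<n. c r * q ^ r) < q ^ n"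
  using assms(2)
proof (induction n)
  case (Suc n)
  have "(\<Sum>r<Suc n. c r * q ^ r) < q ^ n + c n * q ^ n"
    using Suc by simp
  also have "\<dots> = Suc (c n) * q ^ n" by simp
  also have "\<dots> \<le> q * q ^ n"
    using Suc.prems[of n] by (intro mult_right_mono) auto
  finally show ?case by simp
qed auto

lemma digits_unique:
  fixes q :: nat
  assumes "q > 0" "\<And>r. r < n \<Longrightarrow> c r < q" "\<And>r. r < n \<Longrightarrow> d r < q"
    and "(\<Sum>r<n. c r * q ^ r) = (\<Sum>r<n. d r * q ^ r)" and "r < n"
  shows "c r = d r"
  using assms(2-)
proof (induction n)
  case (Suc n)
  define C D where "C = (\<Sum>r<n. c r * q ^ r)" and "D = (\<Sum>r<n. d r * q ^ r)"
  have lt: "C < q ^ n" "D < q ^ n"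
    unfolding C_def D_def using Suc.prems assms(1) by (auto intro!: digit_sum_less)
  have eq: "C + c n * q ^ n = D + d n * q ^ n"
    using Suc.prems by (simp add: C_def D_def)
  have "(C + c n * q ^ n) div q ^ n = c n" "(D + d n * q ^ n) div q ^ n = d n"
    using lt assms(1) by simp_all
  then have cd: "c n = d n" using eq by simp
  then have "C = D" using eq by simp
  then show ?case
    using Suc cd by (cases "r = n") (auto simp: C_def D_def)
qed simp

lemma cong_power_mod:
  fixes q :: nat
  assumes "q > 0"
  shows "[q ^ k = q ^ (k mod n)] (mod (q ^ n - 1))"
proof -
  have "[q ^ n = 1] (mod (q ^ n - 1))"
    using assms by (simp add: cong_altdef_nat)
  then have "[(q ^ n) ^ (k div n) * q ^ (k mod n) = 1 ^ (k div n) * q ^ (k mod n)] (mod (q ^ n - 1))"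
    by (intro cong_mult cong_pow) auto
  moreover have "(q ^ n) ^ (k div n) * q ^ (k mod n) = q ^ k"
    by (metis power_mult power_add mult_div_mod_eq)
  ultimately show ?thesis by simp
qed

lemma geometric_sum_nat:
  fixes q :: nat
  assumes "q > 0"
  shows "(q - 1) * (\<Sum>k<n. q ^ k) = q ^ n - 1"
proof (induction n)
  case (Suc n)
  have "(q - 1) * (\<Sum>k<Suc n. q ^ k) = q ^ n - 1 + (q - 1) * q ^ n"
    using Suc by (simp add: distrib_left)
  also have "\<dots> = q * q ^ n - 1"
    using assms by (cases q) auto
  finally show ?case by simp
qed simp

text \<open>The upper bound is the full geometric sum rather than \<open>q ^ n - 1\<close>, so that
  a factor \<open>q - 1\<close> can still be multiplied in without reaching the modulus.\<close>

lemma proper_power_sum_bounds: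
  fixes q :: nat
  assumes "q > 0" "J \<subset> {..<n}" "J \<noteq> {}"
  shows "0 < (\<Sum>j\<in>J. q ^ j)" "(\<Sum>j\<in>J. q ^ j) < (\<Sum>k<n. q ^ k)"
proof -
  have fin: "finite J" using assms(2) finite_subset by blast
  show "0 < (\<Sum>j\<in>J. q ^ j)"
    using assms fin by (intro sum_pos) auto
  obtain k where "k < n" "k \<notin> J" using assms(2) by auto
  then show "(\<Sum>j\<in>J. q ^ j) < (\<Sum>k<n. q ^ k)"
    using assms by (intro sum_strict_mono2[of _ _ k]) auto
qed

lemma proper_power_sum_less_modulus:
  fixes q :: nat
  assumes "q \<ge> 2" "J \<subset> {..<n}" "J \<noteq> {}"
  shows "(\<Sum>j\<in>J. q ^ j) < q ^ n - 1"
proof -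
  have "1 * (\<Sum>k<n. q ^ k) \<le> (q - 1) * (\<Sum>k<n. q ^ k)"
    using assms(1) by (intro mult_right_mono) auto
  then show ?thesis
    using proper_power_sum_bounds(2)[of q J n] geometric_sum_nat[of q n] assms by linarith
qed

text \<open>Among all ways to write a residue modulo \<open>q ^ n - 1\<close> as a sum of powers of \<open>q\<close>, the digit
  expansion uses the fewest summands: a carry replaces \<open>q\<close> summands by one.\<close>

lemma fewest_powers_mod:
  fixes q :: nat
  assumes q: "q \<ge> 2" and J: "J \<subset> {..<n}" "J \<noteq> {}"
    and "[(\<Sum>r<n. c r * q ^ r) = (\<Sum>j\<in>J. q ^ j)] (mod (q ^ n - 1))"
    and "(\<Sum>r<n. c r) \<le> card J" and "r < n"
  shows "c r = of_bool (r \<in> J)"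
  using assms(4-)
proof (induction "\<Sum>r<n. c r" arbitrary: c r rule: less_induct)
  case less
  define d where "d = (\<Sum>j\<in>J. q ^ j)"
  have dJ: "d = (\<Sum>r<n. of_bool (r \<in> J) * q ^ r)"
    unfolding d_def using J by (intro sum.mono_neutral_cong_left) auto
  have d: "0 < d" "d < q ^ n - 1"
    unfolding d_def
    using proper_power_sum_bounds(1)[of q J n] proper_power_sum_less_modulus[of q J n] q J by auto
  show ?case
  proof (cases "\<forall>r<n. c r < q")
    case True
    then have "(\<Sum>r<n. c r * q ^ r) \<le> q ^ n - 1"
      using digit_sum_less[of q n c] q by fastforce
    moreover have "(\<Sum>r<n. c r * q ^ r) mod (q ^ n - 1) = d"
      using less.prems d by (simp add: cong_def d_def)
    \<comment> \<open>The value could be \<open>q ^ n - 1\<close> itself, but then its residue would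
      be \<open>0\<close> rather than \<open>d\<close>.\<close>
    ultimately have "(\<Sum>r<n. c r * q ^ r) = d"
      using d by (metis le_neq_implies_less mod_less mod_self not_less0)
    then show ?thesis
      using True q less.prems dJ
      by (intro digits_unique[of q n c "\<lambda>r. of_bool (r \<in> J)"]) auto
  next
    case False
    then obtain u where u: "u < n" "q \<le> c u" by (auto simp: not_less)
    \<comment> \<open>A carry out of the top position wraps round to position \<open>0\<close>,
      since \<open>q ^ n\<close> is congruent to \<open>1\<close>.\<close>
    define v where "v = Suc u mod n"
    have "n \<noteq> 1" using J by auto
    then have v: "v < n" "v \<noteq> u"
      using u by (auto simp: v_def mod_Suc)
    define c' where "c' = c(u := c u - q, v := Suc (c v))"
    have rest: "(\<Sum>r<n. f r) = f u + f v + (\<Sum>r\<in>{..<n} - {u, v}. f r)" for f :: "nat \<Rightarrow> nat"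
    proof -
      have "(\<Sum>r<n. f r) = sum f {u, v} + sum f ({..<n} - {u, v})"
        using u v by (subst sum.subset_diff[of "{u, v}"]) auto
      then show ?thesis using v by simp
    qed
    have S: "(\<Sum>r<n. c r) = (\<Sum>r<n. c' r) + (q - 1)"
      unfolding rest[of c] rest[of c'] using u v q by (auto simp: c'_def)
    have V: "(\<Sum>r<n. c r * q ^ r) + q ^ v = (\<Sum>r<n. c' r * q ^ r) + q * q ^ u"
    proof -
      have "c u * q ^ u = (c u - q) * q ^ u + q * q ^ u"
        using u by (simp flip: add_mult_distrib)
      then show ?thesis
        unfolding rest[of "\<lambda>r. c r * q ^ r"] rest[of "\<lambda>r. c' r * q ^ r"]
        using v by (auto simp: c'_def)
    qed
    have "[q * q ^ u = q ^ v] (mod (q ^ n - 1))"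
      using cong_power_mod[of q "Suc u" n] q by (simp add: v_def)
    then have "[(\<Sum>r<n. c' r * q ^ r) + q ^ v = (\<Sum>r<n. c r * q ^ r) + q ^ v] (mod (q ^ n - 1))"
      unfolding V by (intro cong_add cong_refl) (rule cong_sym)
    then have cong': "[(\<Sum>r<n. c' r * q ^ r) = d] (mod (q ^ n - 1))"
      using less.prems(1) unfolding d_def using cong_add_rcancel_nat cong_trans by blast
    \<comment> \<open>By induction \<open>c'\<close> has total \<open>card J\<close>, but the carry
      made it smaller than the total of \<open>c\<close>, which is at most \<open>card J\<close>; so
      the carry case is contradictory.\<close>
    have "c' r = of_bool (r \<in> J)" if "r < n" for r
      using less.hyps[of c' r] S q cong' less.prems that unfolding d_def by auto
    then have "(\<Sum>r<n. c' r) = (\<Sum>r<n. of_bool (r \<in> J))" by simp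
    also have "\<dots> = (\<Sum>r\<in>J. 1)"
      using J by (intro sum.mono_neutral_cong_right) auto
    also have "\<dots> = card J" by simp
    finally show ?thesis using S q less.prems by simp
  qed
qed

text \<open>The multiplicities of the values of \<open>t\<close> have total \<open>card J\<close>,
  so the minimality of digit expansions makes each of them \<open>0\<close> or \<open>1\<close>,
  exactly as for \<open>J\<close>.\<close>

lemma power_sum_cong_imp_image_eq:
  fixes q :: nat
  assumes q: "q \<ge> 2" and J: "J \<subset> {..<n}" "J \<noteq> {}"
    and t: "\<And>j. j \<in> J \<Longrightarrow> t j < n"
    and "[(\<Sum>j\<in>J. q ^ t j) = (\<Sum>j\<in>J. q ^ j)] (mod (q ^ n - 1))"
  shows "t ` J = J"
proof -
  define c where "c r = card {j \<in> J. t j = r}" for r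
  have fin: "finite J" using J finite_subset by blast
  have "(\<Sum>j\<in>J. f (t j)) = (\<Sum>r<n. c r * f r)" for f :: "nat \<Rightarrow> nat"
  proof -
    have "(\<Sum>j\<in>J. f (t j)) = (\<Sum>r<n. \<Sum>j\<in>{j \<in> J. t j = r}. f (t j))"
      using fin t by (intro sum.group[symmetric]) auto
    then show ?thesis by (simp add: c_def)
  qed
  from this[of "\<lambda>r. q ^ r"] this[of "\<lambda>_. 1"]
  have c: "c r = of_bool (r \<in> J)" if "r < n" for r
    using that assms by (intro fewest_powers_mod[of q J n c]) auto
  show ?thesis
  proof (intro equalityI subsetI)
    fix r assume "r \<in> t ` J"
    then have "{j \<in> J. t j = r} \<noteq> {}" "r < n" using t by auto
    then show "r \<in> J" using c[of r] fin by (cases "r \<in> J") (auto simp: c_def)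
  next
    fix r assume "r \<in> J"
    then have "c r = 1" using c[of r] J by auto
    then have "{j \<in> J. t j = r} \<noteq> {}" unfolding c_def by (metis card.empty zero_neq_one)
    then show "r \<in> t ` J" by auto
  qed
qed

subsection \<open>Arithmetic of the finite field\<close>

lemma power_eq_self_of_card:
  fixes x :: "'a::{finite,field}"
  shows "x ^ card (UNIV :: 'a set) = x"
proof (cases "x = 0")
  case False
  have "(\<Prod>y\<in>UNIV - {0}. x * y) = (\<Prod>y\<in>UNIV - {0}. y)"
    by (rule prod.reindex_bij_witness[of _ "\<lambda>y. y / x" "\<lambda>y. x * y"]) (use False in auto)
  then have "x ^ card (UNIV - {0 :: 'a}) * \<Prod>(UNIV - {0 :: 'a}) = 1 * \<Prod>(UNIV - {0 :: 'a})"
    by (simp add: prod.distrib)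
  then have "x ^ card (UNIV - {0 :: 'a}) = 1"
    by (subst (asm) mult_right_cancel) auto
  moreover have "card (UNIV :: 'a set) = Suc (card (UNIV - {0 :: 'a}))"
    using card.remove[of "UNIV :: 'a set" 0] by simp
  ultimately show ?thesis by (metis power_Suc mult.right_neutral)
qed (simp add: power_0_left finite_UNIV_card_ge_0)

text \<open>Sylow gives an additive subgroup of order \<open>r\<close>. Translation by one of its
  nonzero elements \<open>x\<close> leaves the sum of its elements unchanged, so \<open>r\<close>
  times \<open>x\<close> is zero.\<close>

lemma prime_dvd_card_field_imp_CHAR:
  assumes "prime r" "r dvd card (UNIV :: 'a::{finite,field} set)"
  shows "r = CHAR('a)"
proof -
  define G where "G = \<lparr>carrier = (UNIV :: 'a set), monoid.mult = (+), one = (0 :: 'a)\<rparr>"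
  have G: "group G"
    by (rule groupI) (auto simp: G_def add.assoc intro: exI[of _ "- x" for x])
  obtain k where k: "card (UNIV :: 'a set) = r * k" using assms(2) by auto
  obtain H where H: "subgroup H G" "card H = r"
    using sylow_thm[of r G 1 k] assms(1) G k by (auto simp: G_def Coset.order_def)
  have "1 < card H" using H prime_gt_1_nat[OF assms(1)] by simp
  then have "\<not> H \<subseteq> {0}" using card_mono[of "{0}" H] by auto
  then obtain x where x: "x \<in> H" "x \<noteq> 0" by blast
  have fin: "finite H" by (rule finite)
  have "x + h \<in> H" if "h \<in> H" for h
    using subgroup.m_closed[OF H(1) x(1) that] by (simp add: G_def)
  then have "(+) x ` H = H"
    using fin by (intro endo_inj_surj) auto
  then have "(\<Sum>h\<in>H. h) = (\<Sum>h\<in>(+) x ` H. h)" by simp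
  also have "\<dots> = (\<Sum>h\<in>H. x + h)" by (subst sum.reindex) auto
  finally have "of_nat r * x = 0" using H by (simp add: sum.distrib)
  then have "CHAR('a) dvd r" using x by (simp add: of_nat_eq_0_iff_char_dvd)
  then show ?thesis
    using assms(1) CHAR_not_1[where ?'a = 'a] by (metis One_nat_def prime_nat_iff)
qed

lemma card_power_eq_one_le:
  fixes e :: nat
  assumes "e > 0"
  shows "card {x :: 'a::idom. x ^ e = 1} \<le> e"
proof -
  define p :: "'a poly" where "p = monom 1 e - 1"
  have "coeff p e = 1" using assms by (simp add: p_def)
  then have "p \<noteq> 0" by auto
  moreover have "degree p \<le> e"
    unfolding p_def by (intro degree_diff_le degree_monom_le) auto
  moreover have "{x. poly p x = 0} = {x. x ^ e = 1}"
    by (auto simp: p_def poly_monom)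
  ultimately show ?thesis using card_poly_roots_bound[of p] by simp
qed

text \<open>The parameter \<open>T\<close> carries the field type \<open>'a\<close>, which
  \<open>q\<close> and \<open>n\<close> do not mention.\<close>

locale Fqn =
  fixes q n :: nat and T :: "'a::{finite,field} itself"
  assumes q: "2 \<le> q" and card_UNIV: "card (UNIV :: 'a set) = q ^ n"
begin

lemma n_pos: "0 < n"
proof (rule ccontr)
  assume "\<not> 0 < n"
  then have "card (UNIV :: 'a set) = 1" using card_UNIV by simp
  then show False by (metis UNIV_I card_1_singletonE singletonD zero_neq_one)
qed

lemma qn_gt_1: "1 < q ^ n"
  using q n_pos by (intro one_less_power) auto

lemma card_nonzero: "card (UNIV - {0 :: 'a}) = q ^ n - 1"
  by (simp add: card_UNIV card_Diff_singleton)

lemma power_qn: "(x :: 'a) ^ (q ^ n) = x"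
  using power_eq_self_of_card[of x] by (simp add: card_UNIV)

lemma power_qn_minus_1: "(x :: 'a) \<noteq> 0 \<Longrightarrow> x ^ (q ^ n - 1) = 1"
  using power_qn[of x] qn_gt_1 by (cases "q ^ n") auto

lemma power_qk_mod: "(x :: 'a) ^ (q ^ k) = x ^ (q ^ (k mod n))"
proof -
  have "x ^ (q ^ (n * m)) = x" for m
    by (induction m) (simp_all add: power_add power_mult power_qn)
  then have "x ^ (q ^ (n * (k div n) + k mod n)) = x ^ (q ^ (k mod n))"
    unfolding power_add power_mult by simp
  then show ?thesis by simp
qed

text \<open>That \<open>q\<close> is a prime power comes from the cardinality: a prime factor of
  \<open>q\<close> divides \<open>q ^ n\<close>, the order of the field, hence is the
  characteristic.\<close>

lemma q_eq_power_CHAR: "\<exists>e. q = CHAR('a) ^ e"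
proof -
  have "r = CHAR('a)" if "prime r" "r dvd q" for r
    using prime_dvd_card_field_imp_CHAR[where ?'a = 'a, of r] that n_pos card_UNIV
    by (metis dvd_power dvd_trans)
  then have "prime_factors q \<subseteq> {CHAR('a)}"
    by (auto simp: in_prime_factors_iff)
  then have "prime_factorization q = replicate_mset (size (prime_factorization q)) CHAR('a)"
    by (metis set_mset_subset_singletonD)
  then have "prod_mset (prime_factorization q) = CHAR('a) ^ size (prime_factorization q)"
    by (metis prod_mset_replicate_mset)
  then show ?thesis using q by (auto simp: prod_mset_prime_factorization_nat)
qed

lemma prime_CHAR: "prime CHAR('a)"
  by (rule prime_CHAR_semidom) (simp add: finite_imp_CHAR_pos)

lemma frobenius_add: "(x + y :: 'a) ^ (q ^ k) = x ^ (q ^ k) + y ^ (q ^ k)"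
proof -
  obtain e where "q = CHAR('a) ^ e" using q_eq_power_CHAR by blast
  then show ?thesis
    by (intro freshmans_dream'[OF prime_CHAR, of _ "e * k"]) (simp add: power_mult)
qed

lemma frobenius_sum: "(\<Sum>i\<in>A. f i :: 'a) ^ (q ^ k) = (\<Sum>i\<in>A. f i ^ (q ^ k))"
proof -
  obtain e where "q = CHAR('a) ^ e" using q_eq_power_CHAR by blast
  then show ?thesis
    by (intro freshmans_dream_sum'[OF prime_CHAR, of _ "e * k"]) (simp add: power_mult)
qed

lemma frobenius_minus: "(- x :: 'a) ^ (q ^ k) = - (x ^ (q ^ k))"
proof (rule minus_unique[symmetric])
  have "(x + - x) ^ (q ^ k) = 0" using q by simp
  then show "x ^ (q ^ k) + (- x) ^ (q ^ k) = 0" unfolding frobenius_add .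
qed

lemma Fq_power: "c \<in> (Fq q :: 'a set) \<Longrightarrow> c ^ (q ^ k) = c"
  by (induction k) (auto simp: Fq_def power_mult)

lemma Fq_diff: "c \<in> (Fq q :: 'a set) \<Longrightarrow> d \<in> Fq q \<Longrightarrow> c - d \<in> Fq q"
  using frobenius_add[of c "- d" 1] frobenius_minus[of d 1] unfolding Fq_def by simp

lemma zero_in_Fq: "(0 :: 'a) \<in> Fq q" and one_in_Fq: "(1 :: 'a) \<in> Fq q"
  using q by (auto simp: Fq_def)

text \<open>If \<open>q ^ n - 1\<close> does not divide \<open>e\<close>, substituting
  \<open>u * y\<close> for \<open>y\<close> multiplies the sum by \<open>u ^ e\<close>. A nonzero
  \<open>u\<close> with \<open>u ^ e \<noteq> 1\<close> exists by counting roots, without a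
  primitive element.\<close>

lemma sum_powers_nonzero:
  "(\<Sum>y\<in>UNIV - {0 :: 'a}. y ^ e) = (if q ^ n - 1 dvd e then - 1 else 0)"
proof (cases "q ^ n - 1 dvd e")
  case True
  then have "y ^ e = 1" if "y \<noteq> 0" for y :: 'a
    using that power_qn_minus_1[of y] by (auto simp: power_mult)
  then have "(\<Sum>y\<in>UNIV - {0 :: 'a}. y ^ e) = of_nat (q ^ n - 1)"
    by (simp add: card_nonzero)
  also have "\<dots> = of_nat (q ^ n) - (1 :: 'a)"
    using qn_gt_1 by (subst of_nat_diff) auto
  also have "of_nat (q ^ n) = (0 :: 'a)"
  proof -
    \<comment> \<open>Translation by \<open>1\<close> permutes the field, so the sum of
      \<open>1\<close> over all elements vanishes.\<close>
    have "(\<Sum>y\<in>UNIV. y) = (\<Sum>y\<in>UNIV. y + 1 :: 'a)"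
      by (rule sum.reindex_bij_witness[of _ "\<lambda>y. y + 1" "\<lambda>y. y - 1"]) auto
    then show ?thesis by (simp add: sum.distrib card_UNIV)
  qed
  finally show ?thesis using True by simp
next
  case False
  define r where "r = e mod (q ^ n - 1)"
  have r: "0 < r" "r < q ^ n - 1"
    using False qn_gt_1 by (auto simp: r_def dvd_eq_mod_eq_0)
  have er: "y ^ e = y ^ r" if "y \<noteq> 0" for y :: 'a
  proof -
    have "y ^ ((q ^ n - 1) * (e div (q ^ n - 1)) + r) = y ^ r"
      unfolding power_add power_mult using power_qn_minus_1[OF that] by simp
    then show ?thesis by (simp add: r_def)
  qed
  have "\<exists>u :: 'a. u \<noteq> 0 \<and> u ^ r \<noteq> 1"
  proof (rule ccontr)
    assume "\<not> ?thesis"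
    then have "UNIV - {0 :: 'a} \<subseteq> {x. x ^ r = 1}" by auto
    then have "q ^ n - 1 \<le> card {x :: 'a. x ^ r = 1}"
      using card_mono[OF finite] card_nonzero by metis
    then show False using card_power_eq_one_le[of r] r by (metis leD order_trans)
  qed
  then obtain u :: 'a where u: "u \<noteq> 0" "u ^ e \<noteq> 1" using er by metis
  have "(\<Sum>y\<in>UNIV - {0 :: 'a}. y ^ e) = (\<Sum>y\<in>UNIV - {0 :: 'a}. (u * y) ^ e)"
    by (rule sum.reindex_bij_witness[of _ "\<lambda>y. u * y" "\<lambda>y. y / u"]) (use u in auto)
  also have "\<dots> = u ^ e * (\<Sum>y\<in>UNIV - {0 :: 'a}. y ^ e)"
    by (simp add: power_mult_distrib sum_distrib_left)
  finally show ?thesis using u False by simp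
qed

text \<open>The polynomial \<open>X ^ q - X\<close> divides \<open>X ^ (q ^ n) - X\<close>, which splits; here
  \<open>h\<close> is the cofactor of \<open>X ^ (q - 1) - 1\<close> in \<open>X ^ (q ^ n - 1) - 1\<close>.\<close>

lemma card_Fq: "card (Fq q :: 'a set) = q"
proof -
  define \<theta> where "\<theta> = (\<Sum>k<n. q ^ k)"
  have \<theta>: "(q - 1) * \<theta> = q ^ n - 1"
    unfolding \<theta>_def using geometric_sum_nat[of q n] q by simp
  then have \<theta>_pos: "0 < \<theta>" using qn_gt_1 by (cases \<theta>) auto
  define h :: "'a poly" where "h = (\<Sum>k<\<theta>. monom 1 ((q - 1) * k))"
  have ph: "poly h x = (\<Sum>k<\<theta>. (x ^ (q - 1)) ^ k)" for x
    by (simp add: h_def poly_sum poly_monom power_mult)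
  have "h \<noteq> 0"
  proof
    assume "h = 0"
    then have "poly h 0 = 0" by simp
    moreover have "poly h 0 = (\<Sum>k<\<theta>. if k = 0 then 1 else 0)"
      unfolding ph using q by (intro sum.cong) (auto simp: power_0_left)
    ultimately show False using \<theta>_pos by simp
  qed
  have "degree h \<le> (q - 1) * (\<theta> - 1)"
    unfolding h_def
  proof (rule degree_sum_le)
    fix k assume "k \<in> {..<\<theta>}"
    then have "(q - 1) * k \<le> (q - 1) * (\<theta> - 1)" by (intro mult_left_mono) auto
    then show "degree (monom (1 :: 'a) ((q - 1) * k)) \<le> (q - 1) * (\<theta> - 1)"
      using degree_monom_le order_trans by blast
  qed simp
  then have dh: "card {x. poly h x = 0} \<le> q ^ n - 1 - (q - 1)"
    using card_poly_roots_bound[OF \<open>h \<noteq> 0\<close>] \<theta> by (simp add: diff_mult_distrib2)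
  have "UNIV - {0 :: 'a} \<subseteq> {x. x ^ (q - 1) = 1} \<union> {x. poly h x = 0}"
  proof
    fix x :: 'a assume "x \<in> UNIV - {0}"
    then have "(x ^ (q - 1)) ^ \<theta> = 1"
      using power_qn_minus_1[of x] \<theta> by (simp flip: power_mult)
    then have "(x ^ (q - 1) - 1) * poly h x = 0"
      unfolding ph using power_diff_1_eq[of "x ^ (q - 1)" \<theta>] by simp
    then show "x \<in> {x. x ^ (q - 1) = 1} \<union> {x. poly h x = 0}" by auto
  qed
  then have "q ^ n - 1 \<le> card ({x :: 'a. x ^ (q - 1) = 1} \<union> {x. poly h x = 0})"
    using card_mono[OF finite] card_nonzero by metis
  also have "\<dots> \<le> card {x :: 'a. x ^ (q - 1) = 1} + card {x. poly h x = 0}"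
    by (rule card_Un_le)
  finally have "q ^ n - 1 \<le> card {x :: 'a. x ^ (q - 1) = 1} + (q ^ n - 1 - (q - 1))"
    using dh by linarith
  moreover have "q - 1 \<le> q ^ n - 1" 
    using q n_pos self_le_power[of q n] by (intro diff_le_mono) auto
  ultimately have "q - 1 \<le> card {x :: 'a. x ^ (q - 1) = 1}" by linarith
  moreover have "card {x :: 'a. x ^ (q - 1) = 1} \<le> q - 1"
    using q by (intro card_power_eq_one_le) simp
  moreover have "(Fq q :: 'a set) = insert 0 {x. x ^ (q - 1) = 1}"
  proof -
    have "x ^ q = x * x ^ (q - 1)" for x :: 'a
      using q by (cases q) auto
    then show ?thesis by (auto simp: Fq_def)
  qed
  moreover have "(0 :: 'a) \<notin> {x. x ^ (q - 1) = 1}" using q by (simp add: power_0_left)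
  ultimately show ?thesis using q by simp
qed

end

subsection \<open>Power sums of slopes of \<open>q\<close>-polynomials\<close>

text \<open>These are the linearised polynomials of the field. Only the values of \<open>b\<close>
  below \<open>n\<close> matter, so coefficients are compared there only.\<close>

definition qpoly :: "nat \<Rightarrow> nat \<Rightarrow> (nat \<Rightarrow> 'a::field) \<Rightarrow> 'a \<Rightarrow> 'a" where
  "qpoly q n b y = (\<Sum>k<n. b k * y ^ (q ^ k))"

text \<open>Subtraction of \<open>j\<close> modulo \<open>n\<close> inverts addition of
  \<open>j\<close>; adding \<open>n\<close> first keeps the subtraction on \<open>nat\<close> from
  truncating.\<close>

lemma mod_add_sub_cancel:
  fixes k j n :: nat
  assumes "k < n" "j < n"
  shows "((k + j) mod n + n - j) mod n = k" "((k + n - j) mod n + j) mod n = k"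
proof -
  show "((k + j) mod n + n - j) mod n = k"
  proof (cases "k + j < n")
    case False
    then have "(k + j) mod n = k + j - n" using assms by (simp add: mod_if)
    then show ?thesis using False assms by simp
  qed (use assms in simp)
  have "((k + n - j) mod n + j) mod n = (k + n) mod n"
    unfolding mod_add_left_eq using assms by simp
  then show "((k + n - j) mod n + j) mod n = k" using assms by simp
qed

context Fqn
begin

text \<open>Raising to \<open>q ^ j\<close> twists the coefficients by Frobenius and, since
  \<open>y ^ (q ^ k)\<close> depends only on \<open>k\<close> modulo \<open>n\<close>, shifts them
  cyclically: this is row \<open>j\<close> of the Dickson matrix.\<close>

lemma qpoly_power:
  fixes b :: "nat \<Rightarrow> 'a"
  assumes "j < n"
  shows "qpoly q n b y ^ (q ^ j) = (\<Sum>t<n. b ((t + n - j) mod n) ^ (q ^ j) * y ^ (q ^ t))"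
proof -
  have "qpoly q n b y ^ (q ^ j) = (\<Sum>k<n. b k ^ (q ^ j) * y ^ (q ^ (k + j)))"
    by (simp add: qpoly_def frobenius_sum power_mult_distrib power_add flip: power_mult)
  also have "\<dots> = (\<Sum>k<n. b k ^ (q ^ j) * y ^ (q ^ ((k + j) mod n)))"
    by (intro sum.cong refl arg_cong[where f = "(*) _"] power_qk_mod)
  also have "\<dots> = (\<Sum>t<n. b ((t + n - j) mod n) ^ (q ^ j) * y ^ (q ^ t))"
    by (rule sum.reindex_bij_witness[of _ "\<lambda>t. (t + n - j) mod n" "\<lambda>k. (k + j) mod n"])
      (use assms in \<open>auto simp: mod_add_sub_cancel\<close>)
  finally show ?thesis .
qed

text \<open>Up to sign, the sum on the right is the permanent of the principal submatrix indexed by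
  \<open>J\<close> of the Dickson matrix \<open>(b\<^bsub>t-j\<^esub> ^ (q ^ j))\<close>: summing \<open>y ^ e\<close> over \<open>y \<noteq> 0\<close> kills all terms
  of the expanded product except those in which \<open>\<tau>\<close> permutes \<open>J\<close>.\<close>

lemma sum_slope_powers:
  fixes b :: "nat \<Rightarrow> 'a"
  assumes J: "J \<subset> {..<n}" "J \<noteq> {}"
  shows "(\<Sum>y\<in>UNIV - {0}. (qpoly q n b y / y) ^ (\<Sum>j\<in>J. q ^ j)) =
    - (\<Sum>\<tau> | \<tau> \<in> J \<rightarrow>\<^sub>E {..<n} \<and> \<tau> ` J = J. \<Prod>j\<in>J. b ((\<tau> j + n - j) mod n) ^ (q ^ j))"
proof -
  define d where "d = (\<Sum>j\<in>J. q ^ j)"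
  define M where "M j t = b ((t + n - j) mod n) ^ (q ^ j)" for j t
  let ?P = "J \<rightarrow>\<^sub>E {..<n}"
  have fin: "finite J" using J finite_subset by blast
  have finP: "finite ?P" using fin by (intro finite_PiE) auto
  have d: "0 < d" "d < q ^ n - 1"
    unfolding d_def
    using proper_power_sum_bounds(1)[of q J n] proper_power_sum_less_modulus[of q J n] q J by auto
  have slope: "(qpoly q n b y / y) ^ d =
      (\<Sum>\<tau>\<in>?P. (\<Prod>j\<in>J. M j (\<tau> j)) * y ^ ((\<Sum>j\<in>J. q ^ \<tau> j) + (q ^ n - 1 - d)))" if "y \<noteq> 0" for y :: 'a
  proof -
    \<comment> \<open>The exponent \<open>q ^ n - 1 - d\<close> stands for \<open>-d\<close>, so
      that division by \<open>y ^ d\<close> becomes a natural power.\<close>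
    have "y ^ d * y ^ (q ^ n - 1 - d) = 1"
      using d power_qn_minus_1[OF that] by (simp flip: power_add)
    then have "(qpoly q n b y / y) ^ d = qpoly q n b y ^ d * y ^ (q ^ n - 1 - d)"
      using that by (simp add: power_divide field_simps)
    also have "qpoly q n b y ^ d = (\<Prod>j\<in>J. \<Sum>t<n. M j t * y ^ (q ^ t))"
      unfolding d_def power_sum M_def using J by (intro prod.cong refl qpoly_power) auto
    also have "\<dots> = (\<Sum>\<tau>\<in>?P. \<Prod>j\<in>J. M j (\<tau> j) * y ^ (q ^ \<tau> j))"
      using fin by (intro prod_sum_PiE) auto
    finally show ?thesis
      by (simp add: prod.distrib power_sum power_add sum_distrib_right mult.assoc)
  qed
  have "(\<Sum>y\<in>UNIV - {0}. (qpoly q n b y / y) ^ d) =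
      (\<Sum>y\<in>UNIV - {0}. \<Sum>\<tau>\<in>?P. (\<Prod>j\<in>J. M j (\<tau> j)) * y ^ ((\<Sum>j\<in>J. q ^ \<tau> j) + (q ^ n - 1 - d)))"
    by (intro sum.cong refl slope) auto
  also have "\<dots> = (\<Sum>\<tau>\<in>?P. (\<Prod>j\<in>J. M j (\<tau> j)) *
      (\<Sum>y\<in>UNIV - {0}. y ^ ((\<Sum>j\<in>J. q ^ \<tau> j) + (q ^ n - 1 - d))))"
    by (subst sum.swap) (simp add: sum_distrib_left)
  also have "\<dots> = (\<Sum>\<tau>\<in>?P. if \<tau> ` J = J then - (\<Prod>j\<in>J. M j (\<tau> j)) else 0)"
  proof (intro sum.cong refl)
    fix \<tau> assume \<tau>: "\<tau> \<in> ?P"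
    have "q ^ n - 1 dvd (\<Sum>j\<in>J. q ^ \<tau> j) + (q ^ n - 1 - d) \<longleftrightarrow> \<tau> ` J = J"
    proof
      assume "\<tau> ` J = J"
      then have "bij_betw \<tau> J J" using fin by (simp add: bij_betw_def eq_card_imp_inj_on)
      then have "(\<Sum>j\<in>J. q ^ \<tau> j) = d"
        unfolding d_def by (rule sum.reindex_bij_betw)
      then show "q ^ n - 1 dvd (\<Sum>j\<in>J. q ^ \<tau> j) + (q ^ n - 1 - d)"
        using d by simp
    next
      assume "q ^ n - 1 dvd (\<Sum>j\<in>J. q ^ \<tau> j) + (q ^ n - 1 - d)"
      then have "[(\<Sum>j\<in>J. q ^ \<tau> j) + (q ^ n - 1 - d) = d + (q ^ n - 1 - d)] (mod (q ^ n - 1))"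
        using d by (simp add: cong_def)
      then have "[(\<Sum>j\<in>J. q ^ \<tau> j) = d] (mod (q ^ n - 1))"
        by (simp only: cong_add_rcancel_nat)
      then show "\<tau> ` J = J"
        using \<tau> q J unfolding d_def by (intro power_sum_cong_imp_image_eq[of q J n]) auto
    qed
    then show "(\<Prod>j\<in>J. M j (\<tau> j)) * (\<Sum>y\<in>UNIV - {0}. y ^ ((\<Sum>j\<in>J. q ^ \<tau> j) + (q ^ n - 1 - d)))
        = (if \<tau> ` J = J then - (\<Prod>j\<in>J. M j (\<tau> j)) else 0)"
      unfolding sum_powers_nonzero by simp
  qed
  also have "\<dots> = - (\<Sum>\<tau> | \<tau> \<in> ?P \<and> \<tau> ` J = J. \<Prod>j\<in>J. M j (\<tau> j))"
    using finP by (simp add: sum.inter_filter flip: sum_negf) (intro sum.cong, auto)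
  finally show ?thesis unfolding d_def M_def .
qed

text \<open>On the vertex set of a shortest cycle of the circulant digraph with connection set
  \<open>{k. b k \<noteq> 0}\<close>, only the cycle itself contributes to the permanent. Hence there is no
  cycle shorter than \<open>n\<close>, which for a circulant digraph leaves a single generator.\<close>

lemma qpoly_monomial:
  fixes b :: "nat \<Rightarrow> 'a"
  assumes vanish: "\<And>J. J \<subset> {..<n} \<Longrightarrow> J \<noteq> {} \<Longrightarrow>
      (\<Sum>y\<in>UNIV - {0}. (qpoly q n b y / y) ^ (\<Sum>j\<in>J. q ^ j)) = 0"
    and k: "k < n" "b k \<noteq> 0"
  shows "coprime n k" and "\<And>l. l < n \<Longrightarrow> l \<noteq> k \<Longrightarrow> b l = 0"
proof -
  define E where "E = {(x, y). x < n \<and> y < n \<and> b ((y + n - x) mod n) \<noteq> 0}"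
  have shift: "(x, (x + l) mod n) \<in> E" if "x < n" "l < n" "b l \<noteq> 0" for x l
    using that mod_add_sub_cancel(1)[of l n x] by (simp add: E_def add.commute)
  have shifts: "(x, (x + r * l) mod n) \<in> E ^^ r" if "x < n" "l < n" "b l \<noteq> 0" for x l r
  proof (induction r)
    case (Suc r)
    have "((x + r * l) mod n, ((x + r * l) mod n + l) mod n) \<in> E"
      using that by (intro shift) auto
    moreover have "((x + r * l) mod n + l) mod n = (x + Suc r * l) mod n"
      unfolding mod_add_left_eq by (simp add: algebra_simps)
    ultimately show ?case using relpow_Suc_I[OF Suc] by simp
  qed (use that in simp)
  define L where "L = (\<lambda>l. 0 < l \<and> (\<exists>x. (x, x) \<in> E ^^ l))"
  have "L n"
    using shifts[of 0 k n] k by (auto simp: L_def)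
  define m where "m = (LEAST l. L l)"
  have "L m" unfolding m_def by (rule LeastI[of L n]) fact
  have shortest: "m \<le> l" if "0 < l" "(x, x) \<in> E ^^ l" for l x
    unfolding m_def using that by (intro Least_le) (auto simp: L_def)
  have "n \<le> m"
  proof (rule ccontr)
    assume "\<not> n \<le> m"
    then have mn: "m < n" by simp
    obtain s where m: "0 < m" and s: "s m = s 0" "\<And>r. r < m \<Longrightarrow> (s r, s (Suc r)) \<in> E"
      using \<open>L m\<close> unfolding L_def relpow_fun_conv by metis
    have inj: "inj_on s {..<m}"
      by (rule shortest_cycle_chordless(1)[of m s E]) (fact m s shortest)+
    have chord: "s t = s (Suc r)" if "r < m" "t < m" "(s r, s t) \<in> E" for r t
      by (rule shortest_cycle_chordless(2)[of m s E]) (fact m s shortest that)+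
    define J where "J = s ` {..<m}"
    have sn: "s r < n" if "r < m" for r using s(2)[OF that] by (auto simp: E_def)
    have "card J = m" unfolding J_def using inj by (simp add: card_image)
    then have J: "J \<subset> {..<n}" "J \<noteq> {}"
      using sn mn m by (auto simp: J_def)
    have fin: "finite J" by (simp add: J_def)
    \<comment> \<open>\<open>\<sigma>\<close> moves each vertex to its successor on the cycle; the
      restriction to \<open>J\<close> makes it extensional, as membership in
      \<open>J \<rightarrow>\<^sub>E {..<n}\<close> requires.\<close>
    define \<sigma> where "\<sigma> = (\<lambda>j\<in>J. s (Suc (the_inv_into {..<m} s j)))"
    have \<sigma>: "\<sigma> (s r) = s (Suc r)" if "r < m" for r
      using that inj by (simp add: \<sigma>_def J_def the_inv_into_f_f)
    have Suc_J: "s (Suc r) \<in> J" if "r < m" for r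
      using that m s(1) by (cases "Suc r = m") (auto simp: J_def)
    have s0: "s 0 \<in> \<sigma> ` J"
    proof (rule image_eqI[of _ _ "s (m - 1)"])
      show "s 0 = \<sigma> (s (m - 1))" using \<sigma>[of "m - 1"] s(1) m by simp
      show "s (m - 1) \<in> J" using m by (simp add: J_def)
    qed
    have \<sigma>J: "\<sigma> ` J = J"
    proof
      show "\<sigma> ` J \<subseteq> J" using \<sigma> Suc_J by (auto simp: J_def)
      show "J \<subseteq> \<sigma> ` J"
      proof
        fix j assume "j \<in> J"
        then obtain r where r: "j = s r" "r < m" by (auto simp: J_def)
        show "j \<in> \<sigma> ` J"
        proof (cases r)
          case 0
          then show ?thesis using r s0 by simp
        next
          case (Suc r')
          then have "j = \<sigma> (s r')" using r \<sigma>[of r'] by simp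
          then show ?thesis using r Suc by (auto simp: J_def)
        qed
      qed
    qed
    have \<sigma>P: "\<sigma> \<in> J \<rightarrow>\<^sub>E {..<n}" using \<sigma>J J by (auto simp: \<sigma>_def)
    let ?f = "\<lambda>\<tau>. \<Prod>j\<in>J. b ((\<tau> j + n - j) mod n) ^ (q ^ j)"
    have "(\<Sum>\<tau> | \<tau> \<in> J \<rightarrow>\<^sub>E {..<n} \<and> \<tau> ` J = J. ?f \<tau>) = (\<Sum>\<tau>\<in>{\<sigma>}. ?f \<tau>)"
    proof (rule sum.mono_neutral_right)
      show "finite {\<tau> \<in> J \<rightarrow>\<^sub>E {..<n}. \<tau> ` J = J}"
        using fin by (auto intro!: finite_PiE)
      show "{\<sigma>} \<subseteq> {\<tau> \<in> J \<rightarrow>\<^sub>E {..<n}. \<tau> ` J = J}" using \<sigma>P \<sigma>J by simp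
      show "\<forall>\<tau>\<in>{\<tau> \<in> J \<rightarrow>\<^sub>E {..<n}. \<tau> ` J = J} - {\<sigma>}. ?f \<tau> = 0"
      proof (intro ballI, rule ccontr)
        fix \<tau> assume \<tau>: "\<tau> \<in> {\<tau> \<in> J \<rightarrow>\<^sub>E {..<n}. \<tau> ` J = J} - {\<sigma>}" and "?f \<tau> \<noteq> 0"
        then have nz: "b ((\<tau> j + n - j) mod n) \<noteq> 0" if "j \<in> J" for j
          using that fin q by (auto simp: prod_zero_iff)
        \<comment> \<open>A nonzero product means that \<open>\<tau>\<close> follows edges inside
          \<open>J\<close>; with no chords the only such edge from a vertex goes to its
          successor.\<close>
        have "\<tau> j = \<sigma> j" if j: "j \<in> J" for j
        proof -
          obtain r where r: "j = s r" "r < m" using j by (auto simp: J_def)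
          have "\<tau> j \<in> J" using \<tau> j by auto
          then obtain t where t: "\<tau> j = s t" "t < m" by (auto simp: J_def)
          have "(s r, s t) \<in> E"
            using nz[OF j] r t sn by (auto simp: E_def)
          then have "s t = s (Suc r)" using chord r t by blast
          then show ?thesis using r t \<sigma> by simp
        qed
        then have "\<tau> = \<sigma>" using \<tau> \<sigma>P by (intro PiE_ext[of \<tau> J "\<lambda>_. {..<n}" \<sigma>]) auto
        then show False using \<tau> by simp
      qed
    qed
    then have "?f \<sigma> = 0"
      using vanish[OF J] unfolding sum_slope_powers[OF J] by simp
    moreover have "b ((\<sigma> j + n - j) mod n) \<noteq> 0" if "j \<in> J" for j
      using that s(2) \<sigma> by (auto simp: J_def E_def)
    ultimately show False using fin by auto
  qed
  show cop: "coprime n k"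
  proof -
    \<comment> \<open>A common divisor \<open>g > 1\<close> would let \<open>n div g\<close> steps
      of size \<open>k\<close> close up too early.\<close>
    define g where "g = gcd n k"
    have g: "g dvd n" "g dvd k" "0 < g" using n_pos by (auto simp: g_def)
    then have "(n div g) * k = n * (k div g)" by (metis div_mult_swap dvd_div_mult)
    then have "(0, 0) \<in> E ^^ (n div g)"
      using shifts[of 0 k "n div g"] k n_pos by simp
    moreover have "0 < n div g" using g n_pos by (simp add: div_greater_zero_iff dvd_imp_le)
    ultimately have "n \<le> n div g" using shortest \<open>n \<le> m\<close> le_trans by blast
    then have "\<not> 1 < g" using div_less_dividend[of g n] n_pos by linarith
    then have "g = 1" using g by linarith
    then show ?thesis by (simp add: g_def coprime_iff_gcd_eq_1)
  qed
  fix l assume l: "l < n" "l \<noteq> k"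
  show "b l = 0"
  proof (rule ccontr)
    assume bl: "b l \<noteq> 0"
    obtain v where v: "[k * v = 1] (mod n)"
      using cong_solve_coprime_nat[of k n] cop by (auto simp: coprime_commute)
    \<comment> \<open>\<open>r\<close> solves \<open>l + r * k = 0\<close> modulo \<open>n\<close>:
      one step of size \<open>l\<close> and \<open>r\<close> steps of size \<open>k\<close> close
      up. As no closed walk is shorter than \<open>n\<close>, this forces \<open>r = n - 1\<close>,
      which makes \<open>l\<close> and \<open>k\<close> congruent.\<close>
    define r where "r = (v * (n - l)) mod n"
    have "[l + r * k = l + (v * (n - l)) * k] (mod n)"
      unfolding r_def by (intro cong_add cong_mult) auto
    also have "l + (v * (n - l)) * k = l + (k * v) * (n - l)" by (simp add: mult_ac)
    also have "[l + (k * v) * (n - l) = l + 1 * (n - l)] (mod n)"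
      by (intro cong_add cong_mult v) auto
    also have "l + 1 * (n - l) = n" using l by simp
    finally have r: "(l + r * k) mod n = 0" by (simp add: cong_def)
    have "(0, l) \<in> E" using shift[of 0 l] l bl n_pos by simp
    moreover have "(l, 0) \<in> E ^^ r" using shifts[of l k r] l k r by simp
    ultimately have "(0, 0) \<in> E ^^ Suc r" by (rule relpow_Suc_I2)
    then have "n \<le> Suc r" using shortest[of "Suc r" 0] \<open>n \<le> m\<close> by simp
    moreover have "r < n" unfolding r_def using n_pos by simp
    ultimately have "Suc r = n" by simp
    have "l + r * k + k = l + n * k"
      unfolding \<open>Suc r = n\<close>[symmetric] by simp
    then have "(l + r * k + k) mod n = (l + n * k) mod n" by (simp only:)
    then have "(l + r * k + k) mod n = l" using l by simp
    moreover have "(l + r * k + k) mod n = k"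
      using r k by (metis add_0 mod_add_left_eq mod_less)
    ultimately show False using l by simp
  qed
qed

end

subsection \<open>Linear sets of pseudoregulus type\<close>

text \<open>The fibres of either map partition \<open>A\<close> over the same image. Those of
  \<open>\<phi>\<close> all have size \<open>c\<close>, so those of \<open>\<psi>\<close>, being at
  least as large, cannot exceed \<open>c\<close> either, and values are taken equally often.\<close>

lemma sum_comp_eq_of_fibre_cards:
  fixes h :: "'b \<Rightarrow> 'c::semiring_1"
  assumes fin: "finite A" and image: "\<phi> ` A = \<psi> ` A"
    and \<phi>: "\<And>x. x \<in> A \<Longrightarrow> card {y \<in> A. \<phi> y = \<phi> x} = c"
    and \<psi>: "\<And>x. x \<in> A \<Longrightarrow> c \<le> card {y \<in> A. \<psi> y = \<psi> x}"
  shows "(\<Sum>x\<in>A. h (\<phi> x)) = (\<Sum>x\<in>A. h (\<psi> x))"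
proof -
  \<comment> \<open>Polymorphic in \<open>'d\<close>: it serves for counting in \<open>nat\<close>
    and for the sums in \<open>'c\<close>.\<close>
  have group: "(\<Sum>x\<in>A. h (\<chi> x)) = (\<Sum>z\<in>\<chi> ` A. of_nat (card {x \<in> A. \<chi> x = z}) * h z)"
    for h :: "'b \<Rightarrow> 'd::semiring_1" and \<chi> :: "_ \<Rightarrow> 'b"
  proof -
    have "(\<Sum>x\<in>A. h (\<chi> x)) = (\<Sum>z\<in>\<chi> ` A. \<Sum>x\<in>{x \<in> A. \<chi> x = z}. h (\<chi> x))"
      using fin by (intro sum.group[symmetric]) auto
    then show ?thesis by simp
  qed
  have total: "(\<Sum>z\<in>\<psi> ` A. c) = (\<Sum>z\<in>\<psi> ` A. card {x \<in> A. \<psi> x = z})"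
  proof -
    have "(\<Sum>z\<in>\<phi> ` A. c) = (\<Sum>z\<in>\<phi> ` A. card {x \<in> A. \<phi> x = z})"
      using \<phi> by (intro sum.cong) auto
    also have "\<dots> = card A"
      using group[of "\<lambda>_. 1 :: nat" \<phi>] by simp
    also have "\<dots> = (\<Sum>z\<in>\<psi> ` A. card {x \<in> A. \<psi> x = z})"
      using group[of "\<lambda>_. 1 :: nat" \<psi>] by simp
    finally show ?thesis using image by simp
  qed
  have \<psi>_eq: "card {x \<in> A. \<psi> x = z} = c" if z: "z \<in> \<psi> ` A" for z
    by (rule sum_mono_inv[OF total _ z, symmetric]) (use fin \<psi> in auto)
  have "(\<Sum>x\<in>A. h (\<phi> x)) = (\<Sum>z\<in>\<phi> ` A. of_nat c * h z)"
    unfolding group using \<phi> by (intro sum.cong) auto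
  also have "\<dots> = (\<Sum>z\<in>\<psi> ` A. of_nat (card {x \<in> A. \<psi> x = z}) * h z)"
    unfolding image using \<psi>_eq by (intro sum.cong) auto
  also have "\<dots> = (\<Sum>x\<in>A. h (\<psi> x))" unfolding group ..
  finally show ?thesis .
qed

lemma fst_sum_smult2: "fst (\<Sum>w\<in>B. smult2 (c w) w) = (\<Sum>w\<in>B. c w * fst w)"
  and snd_sum_smult2: "snd (\<Sum>w\<in>B. smult2 (c w) w) = (\<Sum>w\<in>B. c w * snd w)"
  by (induction B rule: infinite_finite_induct) (simp_all add: smult2_def)

lemma Fqn_point_eq_imp_slope_eq:
  assumes "Fqn_point u = Fqn_point v" "fst u \<noteq> 0"
  shows "fst v \<noteq> 0" "snd u / fst u = snd v / fst v"
proof -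
  have "smult2 1 u \<in> Fqn_point u" unfolding Fqn_point_def by blast
  then have "u \<in> Fqn_point v" using assms by (simp add: smult2_def)
  then obtain c where "u = smult2 c v" by (auto simp: Fqn_point_def)
  then have "fst u = c * fst v" "snd u = c * snd v" by (auto simp: smult2_def)
  then show "fst v \<noteq> 0" "snd u / fst u = snd v / fst v" using assms(2) by auto
qed

section \<open>\<open>q\<close>-polynomials, subspaces and slopes\<close>

context Fqn
begin

text \<open>The degree is at most \<open>q ^ (n - 1)\<close>, too small for \<open>q ^ n\<close>
  roots unless the polynomial is zero.\<close>

lemma qpoly_eq_zero_imp_coeffs_zero:
  fixes b :: "nat \<Rightarrow> 'a"
  assumes "\<And>y. qpoly q n b y = 0" "k < n"
  shows "b k = 0"
proof -
  define p :: "'a poly" where "p = (\<Sum>k<n. monom (b k) (q ^ k))"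
  have "poly p y = 0" for y
    using assms(1)[of y] by (simp add: p_def poly_sum poly_monom qpoly_def)
  then have "{y. poly p y = 0} = UNIV" by auto
  moreover have "degree p < q ^ n"
  proof -
    have "degree p \<le> q ^ (n - 1)"
      unfolding p_def
    proof (rule degree_sum_le)
      fix k assume "k \<in> {..<n}"
      then have "q ^ k \<le> q ^ (n - 1)" using q by (intro power_increasing) auto
      then show "degree (monom (b k) (q ^ k)) \<le> q ^ (n - 1)"
        using degree_monom_le order_trans by blast
    qed simp
    also have "\<dots> < q ^ n" using q n_pos by (intro power_strict_increasing) auto
    finally show ?thesis .
  qed
  ultimately have "p = 0" using card_poly_roots_bound[of p] card_UNIV by force
  then have "0 = coeff p (q ^ k)" by simp
  also have "\<dots> = (\<Sum>l<n. if l = k then b l else 0)"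
    unfolding p_def coeff_sum using q by (intro sum.cong) (auto simp: power_inject_exp)
  finally show ?thesis using assms(2) by simp
qed

lemma qpoly_diff: "qpoly q n (\<lambda>k. b k - c k) y = qpoly q n b y - qpoly q n c (y :: 'a)"
  unfolding qpoly_def by (simp add: left_diff_distrib sum_subtractf)

lemma qpoly_combination:
  fixes b :: "nat \<Rightarrow> 'a"
  assumes "\<And>w. w \<in> B \<Longrightarrow> c w \<in> Fq q"
  shows "qpoly q n b (\<Sum>w\<in>B. c w * f w) = (\<Sum>w\<in>B. c w * qpoly q n b (f w))"
proof -
  have "qpoly q n b (\<Sum>w\<in>B. c w * f w) = (\<Sum>k<n. \<Sum>w\<in>B. c w * (b k * f w ^ (q ^ k)))"
    unfolding qpoly_def frobenius_sum sum_distrib_left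
    using assms by (intro sum.cong refl) (simp add: power_mult_distrib Fq_power)
  also have "\<dots> = (\<Sum>w\<in>B. c w * qpoly q n b (f w))"
    by (subst sum.swap) (simp add: qpoly_def sum_distrib_left)
  finally show ?thesis .
qed

lemma card_Fq_subspace_dim:
  fixes W :: "('a \<times> 'a) set"
  assumes "Fq_subspace_dim q W m"
  shows "card W = q ^ m"
proof -
  obtain B where B: "finite B" "card B = m" "Fq_lin_indep q B" "Fq_span q B = W"
    using assms by (auto simp: Fq_subspace_dim_def)
  let ?f = "\<lambda>c. \<Sum>w\<in>B. smult2 (c w) w"
  let ?P = "B \<rightarrow>\<^sub>E (Fq q :: 'a set)"
  have "inj_on ?f ?P"
  proof (rule inj_onI)
    fix c d assume cd: "c \<in> ?P" "d \<in> ?P" "?f c = ?f d"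
    have "(\<Sum>w\<in>B. smult2 (c w - d w) w) = ?f c - ?f d"
      unfolding sum_subtractf[symmetric]
      by (intro sum.cong refl) (simp add: smult2_def minus_prod_def algebra_simps)
    then have "(\<Sum>w\<in>B. smult2 (c w - d w) w) = (0, 0)"
      using cd by (simp add: zero_prod_def)
    moreover have "\<forall>w\<in>B. c w - d w \<in> Fq q" using cd by (auto intro!: Fq_diff)
    ultimately have "\<forall>w\<in>B. c w - d w = 0"
      using B(3)[unfolded Fq_lin_indep_def, rule_format, of "\<lambda>w. c w - d w"] by blast
    then show "c = d" using cd by (intro PiE_ext[of c B "\<lambda>_. Fq q" d]) auto
  qed
  moreover have "?f ` ?P = W"
  proof
    show "?f ` ?P \<subseteq> W" using B(4) by (auto simp: Fq_span_def)
    show "W \<subseteq> ?f ` ?P"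
    proof
      fix x assume "x \<in> W"
      then obtain c where c: "x = ?f c" "\<forall>w\<in>B. c w \<in> Fq q"
        using B(4) by (auto simp: Fq_span_def)
      then have "x = ?f (restrict c B)" "restrict c B \<in> ?P" by auto
      then show "x \<in> ?f ` ?P" by blast
    qed
  qed
  ultimately have "card W = card ?P" using card_image[of ?f ?P] by (simp only:)
  then show ?thesis using B card_Fq by (simp add: card_PiE)
qed

text \<open>Interpolation on a basis of \<open>W\<close>: evaluating \<open>q\<close>-polynomials at the \<open>n\<close> first coordinates is
  an injective map between sets of the same size \<open>(q ^ n) ^ n\<close>, hence surjective.\<close>

lemma subspace_is_qpoly_graph:
  fixes W :: "('a \<times> 'a) set"
  assumes W: "Fq_subspace_dim q W n" and inj: "inj_on fst W"
  obtains b where "W = {(y, qpoly q n b y) | y. True}"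
proof -
  have "card (fst ` W) = card (UNIV :: 'a set)"
    using card_Fq_subspace_dim[OF W] card_image[OF inj] card_UNIV by simp
  then have fst_W: "fst ` W = UNIV" by (intro card_subset_eq) auto
  obtain B where B: "finite B" "card B = n" "Fq_span q B = W"
    using W by (auto simp: Fq_subspace_dim_def)
  have span: "\<exists>c. (\<forall>w\<in>B. c w \<in> Fq q) \<and> fst u = (\<Sum>w\<in>B. c w * fst w) \<and> snd u = (\<Sum>w\<in>B. c w * snd w)"
    if "u \<in> W" for u
    using that B(3) fst_sum_smult2[of _ B] snd_sum_smult2[of _ B] unfolding Fq_span_def by fastforce
  let ?C = "{..<n} \<rightarrow>\<^sub>E (UNIV :: 'a set)" and ?D = "B \<rightarrow>\<^sub>E (UNIV :: 'a set)"
  let ?ev = "\<lambda>b. \<lambda>w\<in>B. qpoly q n b (fst w)"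
  have "inj_on ?ev ?C"
  proof (rule inj_onI)
    fix b c assume bc: "b \<in> ?C" "c \<in> ?C" "?ev b = ?ev c"
    \<comment> \<open>Agreement on the first coordinates of \<open>B\<close> extends by
      \<open>F_q\<close>-linearity to their span, which is the whole field.\<close>
    have "qpoly q n (\<lambda>k. b k - c k) y = 0" for y
    proof -
      obtain u where u: "u \<in> W" "y = fst u" using fst_W by (metis UNIV_I imageE)
      obtain e where e: "\<And>w. w \<in> B \<Longrightarrow> e w \<in> Fq q" "y = (\<Sum>w\<in>B. e w * fst w)"
        using span[OF u(1)] u(2) by auto
      have "qpoly q n (\<lambda>k. b k - c k) (fst w) = 0" if "w \<in> B" for w
        using fun_cong[OF bc(3), of w] that by (simp add: qpoly_diff)
      then show ?thesis
        unfolding e(2) by (subst qpoly_combination) (auto simp: e(1))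
    qed
    then have "b k - c k = 0" if "k < n" for k
      using qpoly_eq_zero_imp_coeffs_zero[of "\<lambda>k. b k - c k"] that by blast
    then show "b = c" using bc by (intro PiE_ext[of b "{..<n}" "\<lambda>_. UNIV" c]) auto
  qed
  then have "card (?ev ` ?C) = card ?D" using B by (simp add: card_image card_PiE)
  moreover have "?ev ` ?C \<subseteq> ?D" by (intro image_subsetI) simp
  moreover have "finite ?D" using B by (intro finite_PiE) auto
  ultimately have "?ev ` ?C = ?D" by (intro card_subset_eq)
  moreover have "restrict snd B \<in> ?D" by simp
  ultimately have "restrict snd B \<in> ?ev ` ?C" by (simp only:)
  then obtain b where b: "restrict snd B = ?ev b" by (rule imageE)
  have bB: "qpoly q n b (fst w) = snd w" if "w \<in> B" for w
    using fun_cong[OF b, of w] that by simp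
  have graph: "snd u = qpoly q n b (fst u)" if u: "u \<in> W" for u
  proof -
    obtain e where e: "\<And>w. w \<in> B \<Longrightarrow> e w \<in> Fq q" "fst u = (\<Sum>w\<in>B. e w * fst w)"
        "snd u = (\<Sum>w\<in>B. e w * snd w)"
      using span[OF u] by auto
    show ?thesis unfolding e(2,3) using bB by (subst qpoly_combination) (auto simp: e(1))
  qed
  have "W = {(y, qpoly q n b y) | y. True}"
  proof (intro equalityI subsetI)
    fix u assume "u \<in> W"
    then show "u \<in> {(y, qpoly q n b y) | y. True}" using graph[of u] by (cases u) auto
  next
    fix u assume "u \<in> {(y, qpoly q n b y) | y. True}"
    then obtain y where y: "u = (y, qpoly q n b y)" by auto
    obtain v where v: "v \<in> W" "y = fst v" using fst_W by (metis UNIV_I imageE)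
    then have "u = v" using y graph[of v] by (simp add: prod_eq_iff)
    then show "u \<in> W" using v by simp
  qed
  then show thesis by (rule that)
qed

text \<open>With \<open>v\<close> inverse to \<open>i\<close> modulo \<open>n\<close>, iterating the
  map \<open>v\<close> times turns the exponent \<open>q ^ i\<close> into \<open>q\<close>, and a
  fixed point stays fixed.\<close>

lemma power_coprime_frobenius:
  assumes "coprime n i" and "(u :: 'a) ^ (q ^ i) = u"
  shows "u \<in> Fq q"
proof -
  obtain v where v: "[i * v = 1] (mod n)"
    using cong_solve_coprime_nat[of i n] assms(1) by (auto simp: coprime_commute)
  have "u ^ (q ^ (i * v)) = u"
    by (induction v) (simp_all add: power_add power_mult assms(2))
  moreover have "u ^ (q ^ (i * v)) = u ^ (q ^ 1)"
    using v power_qk_mod[of u "i * v"] power_qk_mod[of u 1] by (simp add: cong_def)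
  ultimately show ?thesis by (simp add: Fq_def)
qed

text \<open>The slope is \<open>a * x ^ (q ^ i - 1)\<close>, so a nonzero power sum with exponent
  \<open>d\<close> would force \<open>q ^ i * d\<close> and \<open>d\<close> to be congruent modulo
  \<open>q ^ n - 1\<close>. Coprimality improves this to \<open>q * d\<close> and \<open>d\<close>,
  whence \<open>q ^ n - 1\<close> divides the smaller positive number
  \<open>(q - 1) * d\<close>.\<close>

lemma sum_pseudoregulus_slope_powers:
  fixes a :: 'a
  assumes "coprime n i" and J: "J \<subset> {..<n}" "J \<noteq> {}"
  shows "(\<Sum>x\<in>UNIV - {0}. (a * x ^ (q ^ i) / x) ^ (\<Sum>j\<in>J. q ^ j)) = 0"
proof -
  define d where "d = (\<Sum>j\<in>J. q ^ j)"
  have d: "0 < d" "d < (\<Sum>k<n. q ^ k)"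
    using proper_power_sum_bounds[of q J n] q J unfolding d_def by auto
  have "\<not> q ^ n - 1 dvd (q ^ i - 1) * d"
  proof
    assume "q ^ n - 1 dvd (q ^ i - 1) * d"
    then have "[(q ^ i - 1) * d + d = 0 + d] (mod (q ^ n - 1))"
      by (intro cong_add cong_refl) (simp add: cong_0_iff)
    moreover have "(q ^ i - 1) * d + d = q ^ i * d"
      using q by (simp add: diff_mult_distrib)
    ultimately have step: "[q ^ i * d = d] (mod (q ^ n - 1))" by simp
    have iter: "[q ^ (i * v) * d = d] (mod (q ^ n - 1))" for v
    proof (induction v)
      case (Suc v)
      have "[q ^ i * (q ^ (i * v) * d) = q ^ i * d] (mod (q ^ n - 1))"
        by (intro cong_mult cong_refl Suc)
      then show ?case using step by (simp add: power_add mult.assoc cong_trans)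
    qed simp
    obtain v where v: "[i * v = 1] (mod n)"
      using cong_solve_coprime_nat[of i n] assms(1) by (auto simp: coprime_commute)
    have "[q ^ (i * v) = q ^ 1] (mod (q ^ n - 1))"
      using v cong_power_mod[of q "i * v" n] cong_power_mod[of q 1 n] q
      unfolding cong_def by simp
    then have "[q ^ (i * v) * d = q * d] (mod (q ^ n - 1))"
      by (intro cong_mult) simp_all
    then have "[q * d = d] (mod (q ^ n - 1))"
      using iter[of v] cong_trans cong_sym by blast
    moreover have "q * d = (q - 1) * d + d" using q by (simp add: diff_mult_distrib)
    ultimately have "[(q - 1) * d + d = 0 + d] (mod (q ^ n - 1))" by simp
    then have "q ^ n - 1 dvd (q - 1) * d"
      by (simp only: cong_add_rcancel_nat cong_0_iff)
    moreover have "0 < (q - 1) * d" using q d by simp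
    ultimately have "q ^ n - 1 \<le> (q - 1) * d" by (rule dvd_imp_le)
    moreover have "(q - 1) * d < (q - 1) * (\<Sum>k<n. q ^ k)" using q d by simp
    ultimately show False using geometric_sum_nat[of q n] q by linarith
  qed
  then have "(\<Sum>x\<in>UNIV - {0 :: 'a}. x ^ ((q ^ i - 1) * d)) = 0"
    by (simp add: sum_powers_nonzero)
  moreover have "(a * x ^ (q ^ i) / x) ^ d = a ^ d * x ^ ((q ^ i - 1) * d)" if "x \<noteq> 0" for x
  proof -
    have "x ^ (q ^ i) = x ^ (q ^ i - 1) * x"
      using q by (metis power_minus_mult zero_less_power less_le_trans zero_less_numeral)
    then show ?thesis using that by (simp add: power_mult_distrib power_mult)
  qed
  ultimately show ?thesis
    unfolding d_def[symmetric] by (simp flip: sum_distrib_left)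
qed

text \<open>Both slope maps are constant on cosets of \<open>F\<^sub>q\<^sup>*\<close>, and the slopes of \<open>a x ^ (q ^ i)\<close>
  separate these cosets. As the two maps have the same image, so do those of \<open>b\<close>.\<close>

lemma sum_slopes_eq:
  fixes a :: 'a and b :: "nat \<Rightarrow> 'a" and h :: "'a \<Rightarrow> 'a"
  assumes "coprime n i" "a \<noteq> 0"
    and image: "(\<lambda>x. a * x ^ (q ^ i) / x) ` (UNIV - {0}) = (\<lambda>y. qpoly q n b y / y) ` (UNIV - {0})"
  shows "(\<Sum>x\<in>UNIV - {0}. h (a * x ^ (q ^ i) / x)) = (\<Sum>y\<in>UNIV - {0}. h (qpoly q n b y / y))"
proof (rule sum_comp_eq_of_fibre_cards[where c = "q - 1" and h = h, OF finite image])
  have card_coset: "card ((\<lambda>c. c * x) ` (Fq q - {0})) = q - 1" if "x \<noteq> 0" for x :: 'a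
  proof -
    have "inj_on (\<lambda>c. c * x) (Fq q - {0})" using that by (auto intro: inj_onI)
    then show ?thesis using zero_in_Fq by (simp add: card_image card_Fq)
  qed
  fix x :: 'a assume "x \<in> UNIV - {0}"
  then have x: "x \<noteq> 0" by simp
  have "{y \<in> UNIV - {0}. a * y ^ (q ^ i) / y = a * x ^ (q ^ i) / x} = (\<lambda>c. c * x) ` (Fq q - {0})"
  proof (intro equalityI subsetI)
    fix y assume "y \<in> {y \<in> UNIV - {0}. a * y ^ (q ^ i) / y = a * x ^ (q ^ i) / x}"
    then have y: "y \<noteq> 0" "y ^ (q ^ i) * x = x ^ (q ^ i) * y"
      using assms(2) x by (auto simp: field_simps)
    \<comment> \<open>Equal slopes mean that the ratio \<open>y / x\<close> is fixed by the
      \<open>i\<close>-th Frobenius power.\<close>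
    then have "(y / x) ^ (q ^ i) = y / x" using x by (simp add: power_divide field_simps)
    then have "y / x \<in> Fq q" using power_coprime_frobenius assms(1) by blast
    then show "y \<in> (\<lambda>c. c * x) ` (Fq q - {0})"
      using x y by (intro image_eqI[of _ _ "y / x"]) auto
  next
    fix y assume "y \<in> (\<lambda>c. c * x) ` (Fq q - {0})"
    then obtain c where c: "c \<in> Fq q" "c \<noteq> 0" "y = c * x" by auto
    then have "y ^ (q ^ i) = c * x ^ (q ^ i)" by (simp add: power_mult_distrib Fq_power)
    then show "y \<in> {y \<in> UNIV - {0}. a * y ^ (q ^ i) / y = a * x ^ (q ^ i) / x}"
      using c x by simp
  qed
  then show "card {y \<in> UNIV - {0}. a * y ^ (q ^ i) / y = a * x ^ (q ^ i) / x} = q - 1"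
    using card_coset[OF x] by simp
  have scale: "qpoly q n b (c * x) = c * qpoly q n b x" if "c \<in> Fq q" for c
    using qpoly_combination[of "{0}" "\<lambda>_. c" b "\<lambda>_. x"] that by simp
  have "(\<lambda>c. c * x) ` (Fq q - {0}) \<subseteq> {y \<in> UNIV - {0}. qpoly q n b y / y = qpoly q n b x / x}"
    using x by (auto simp: scale)
  then show "q - 1 \<le> card {y \<in> UNIV - {0}. qpoly q n b y / y = qpoly q n b x / x}"
    unfolding card_coset[OF x, symmetric] by (intro card_mono finite)
qed

text \<open>The norm is the product of the conjugates, which Frobenius permutes cyclically. Reducing
  \<open>i\<close> modulo \<open>n\<close> brings the shift into the range required by
  \<open>mod_add_sub_cancel\<close>.\<close>

lemma norm_power_frobenius: "norm_qn q n (x ^ (q ^ i)) = norm_qn q n (x :: 'a)"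
proof -
  have norm: "norm_qn q n y = (\<Prod>k<n. y ^ (q ^ k))" for y :: 'a
    by (simp add: norm_qn_def power_sum)
  have "norm_qn q n (x ^ (q ^ i)) = (\<Prod>k<n. x ^ (q ^ (k + i)))"
    unfolding norm power_mult[symmetric] power_add by (simp only: mult.commute)
  also have "\<dots> = (\<Prod>k<n. x ^ (q ^ ((k + i mod n) mod n)))"
    by (intro prod.cong refl) (subst power_qk_mod, simp add: mod_add_right_eq)
  also have "\<dots> = (\<Prod>t<n. x ^ (q ^ t))"
    by (rule prod.reindex_bij_witness[of _ "\<lambda>t. (t + n - i mod n) mod n" "\<lambda>k. (k + i mod n) mod n"])
      (use n_pos in \<open>auto simp: mod_add_sub_cancel\<close>)
  finally show ?thesis by (simp add: norm)
qed

end

section \<open>Comparison of \<open>W\<close> with the given graph\<close>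

theorem mainTheorem16:
  fixes a :: "'a::{finite, field}" and q n i :: nat and W :: "('a \<times> 'a) set"
  assumes "q \<ge> 2" and "card (UNIV :: 'a set) = q ^ n"
    and "a \<noteq> 0" and "coprime n i"
    and "Fq_subspace_dim q W n"
    and "linset {(x, a * x ^ (q ^ i)) | x. True} = linset W"
  shows "\<exists>j b. coprime n j \<and> b \<noteq> 0 \<and> norm_qn q n b = norm_qn q n a \<and>
           W = {(y, b * y ^ (q ^ j)) | y. True}"
proof -
  interpret Fqn q n "TYPE('a)" by unfold_locales fact+
  define U where "U = {(x, a * x ^ (q ^ i)) | x. True}"
  have LU: "linset U = linset W" using assms(6) by (simp add: U_def)
  have U_fst: "fst u \<noteq> 0" if "u \<in> U" "u \<noteq> (0, 0)" for u
    using that \<open>q \<ge> 2\<close> by (auto simp: U_def power_0_left)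
  have linset_iff: "P \<in> linset X \<longleftrightarrow> (\<exists>u\<in>X - {(0, 0)}. Fqn_point u = P)"
    for P and X :: "('a \<times> 'a) set"
    unfolding linset_def by auto
  have W_to_U: "\<exists>u\<in>U - {(0, 0)}. Fqn_point u = Fqn_point w" if "w \<in> W" "w \<noteq> (0, 0)" for w
    using that LU linset_iff[of "Fqn_point w" U] linset_iff[of "Fqn_point w" W] by auto
  have U_to_W: "\<exists>w\<in>W - {(0, 0)}. Fqn_point w = Fqn_point u" if "u \<in> U" "u \<noteq> (0, 0)" for u
    using that LU linset_iff[of "Fqn_point u" U] linset_iff[of "Fqn_point u" W] by auto
  have W_fst: "fst w \<noteq> 0" if w: "w \<in> W" "w \<noteq> (0, 0)" for w
    using W_to_U[OF w] U_fst Fqn_point_eq_imp_slope_eq(1) by blast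
  have sub: "Fq_subspace q W" using assms(5) by (simp add: Fq_subspace_dim_def)
  \<comment> \<open>Two vectors of \<open>W\<close> with equal first coordinates differ by a
    multiple of \<open>(0, 1)\<close> in \<open>W\<close>, and \<open>W\<close> contains no nonzero
    one.\<close>
  have "inj_on fst W"
  proof (rule inj_onI)
    fix u v assume uv: "u \<in> W" "v \<in> W" "fst u = fst v"
    have "- 1 \<in> (Fq q :: 'a set)" using Fq_diff[OF zero_in_Fq one_in_Fq] by simp
    then have "u + smult2 (- 1) v \<in> W" using sub uv by (auto simp: Fq_subspace_def)
    then have "u + smult2 (- 1) v = (0, 0)"
      using W_fst[of "u + smult2 (- 1) v"] uv(3) by (auto simp: smult2_def)
    then show "u = v" by (simp add: smult2_def prod_eq_iff)
  qed
  then obtain b where Wb: "W = {(y, qpoly q n b y) | y. True}"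
    using subspace_is_qpoly_graph[OF assms(5)] by blast
  have image: "(\<lambda>x. a * x ^ (q ^ i) / x) ` (UNIV - {0}) = (\<lambda>y. qpoly q n b y / y) ` (UNIV - {0})"
  proof (intro equalityI subsetI)
    fix z assume "z \<in> (\<lambda>x. a * x ^ (q ^ i) / x) ` (UNIV - {0})"
    then obtain x where x: "x \<noteq> 0" "z = a * x ^ (q ^ i) / x" by auto
    then have "(x, a * x ^ (q ^ i)) \<in> U" "(x, a * x ^ (q ^ i)) \<noteq> (0, 0)" by (auto simp: U_def)
    then obtain w where w: "w \<in> W" "Fqn_point (x, a * x ^ (q ^ i)) = Fqn_point w"
      using U_to_W by (metis DiffD1)
    then have "fst w \<noteq> 0" "z = snd w / fst w"
      using Fqn_point_eq_imp_slope_eq[OF w(2)] x by auto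
    moreover have "snd w = qpoly q n b (fst w)" using w(1) Wb by auto
    ultimately show "z \<in> (\<lambda>y. qpoly q n b y / y) ` (UNIV - {0})" by auto
  next
    fix z assume "z \<in> (\<lambda>y. qpoly q n b y / y) ` (UNIV - {0})"
    then obtain y where y: "y \<noteq> 0" "z = qpoly q n b y / y" by auto
    then have "(y, qpoly q n b y) \<in> W" "(y, qpoly q n b y) \<noteq> (0, 0)" by (auto simp: Wb)
    then obtain u where u: "u \<in> U" "Fqn_point (y, qpoly q n b y) = Fqn_point u"
      using W_to_U by (metis DiffD1)
    then have "fst u \<noteq> 0" "z = snd u / fst u"
      using Fqn_point_eq_imp_slope_eq[OF u(2)] y by auto
    moreover have "snd u = a * fst u ^ (q ^ i)" using u(1) by (auto simp: U_def)
    ultimately show "z \<in> (\<lambda>x. a * x ^ (q ^ i) / x) ` (UNIV - {0})" by auto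
  qed
  have vanish: "(\<Sum>y\<in>UNIV - {0}. (qpoly q n b y / y) ^ (\<Sum>j\<in>J. q ^ j)) = 0"
    if J: "J \<subset> {..<n}" "J \<noteq> {}" for J
    using sum_slopes_eq[OF assms(4,3) image, of "\<lambda>z. z ^ (\<Sum>j\<in>J. q ^ j)"]
      sum_pseudoregulus_slope_powers[OF assms(4) J, of a] by simp
  \<comment> \<open>Otherwise all slopes of \<open>W\<close> would be \<open>0\<close>, while
    \<open>x = 1\<close> gives the slope \<open>a\<close>.\<close>
  have "\<exists>k<n. b k \<noteq> 0"
  proof (rule ccontr)
    assume "\<not> ?thesis"
    then have "qpoly q n b y = 0" for y by (simp add: qpoly_def)
    moreover have "a * 1 ^ (q ^ i) / 1 \<in> (\<lambda>x. a * x ^ (q ^ i) / x) ` (UNIV - {0})"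
      by (rule imageI) simp
    ultimately show False using image assms(3) by auto
  qed
  then obtain k where k: "k < n" "b k \<noteq> 0" by blast
  have mono: "qpoly q n b y = b k * y ^ (q ^ k)" for y
  proof -
    have "qpoly q n b y = (\<Sum>l<n. if l = k then b l * y ^ (q ^ l) else 0)"
      unfolding qpoly_def using qpoly_monomial(2)[of b k] vanish k by (intro sum.cong) auto
    then show ?thesis using k by simp
  qed
  \<comment> \<open>\<open>y = 1\<close> has slope \<open>b k\<close>, so some nonzero
    \<open>x\<close> satisfies \<open>b k * x = a * x ^ (q ^ i)\<close>; the norms of
    \<open>x\<close> and \<open>x ^ (q ^ i)\<close> then cancel.\<close>
  have "b k \<in> (\<lambda>y. qpoly q n b y / y) ` (UNIV - {0})"
    by (rule image_eqI[of _ _ 1]) (auto simp: mono)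
  then obtain x where "x \<noteq> 0" "b k = a * x ^ (q ^ i) / x"
    unfolding image[symmetric] by auto
  then have x: "x \<noteq> 0" "b k * x = a * x ^ (q ^ i)" by auto
  have "norm_qn q n (b k) * norm_qn q n x = norm_qn q n a * norm_qn q n (x ^ (q ^ i))"
    using arg_cong[OF x(2), of "norm_qn q n"] by (simp add: norm_qn_def power_mult_distrib)
  moreover have "norm_qn q n x \<noteq> 0" using x by (simp add: norm_qn_def)
  ultimately have "norm_qn q n (b k) = norm_qn q n a" by (simp add: norm_power_frobenius)
  moreover have "coprime n k" using qpoly_monomial(1)[of b k] vanish k by blast
  moreover have "W = {(y, b k * y ^ (q ^ k)) | y. True}" unfolding Wb mono ..
  ultimately show ?thesis using k(2) by blast
qed

end
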